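(* Let $\mathcal{X}$ be an infinite-dimensional real Banach space and let $\mathcal{A}\subset\mathcal{B}(\mathcal{X})$ be an $L$-algebra. Then $\mathcal{A}$ is $(1/4)$-dense.
   Context: $\mathcal{B}(\mathcal{X})$ denotes the algebra of all bounded linear operators on $\mathcal{X}$. An algebra of operators on $\mathcal{X}$ is a (real) subalgebra of $\mathcal{B}(\mathcal{X})$, not assumed unital or closed. It is transitive if for any $\varepsilon>0$ and any $x,y\in\mathcal{X}$ with $x\neq 0$ there is $T\in\mathcal{A}$ with $\|Tx-y\|<\varepsilon$ (equivalently, it has no non-trivial closed invariant subspaces). An $L$-algebra is a transitive algebra of operators on $\mathcal{X}$ that contains a non-zero finite rank operator. For $k\in\mathbb{N}$, an algebra $\mathcal{A}$ is $(1/k)$-dense if for any $\varepsilon>0$, any $n\ge 1$, every linearly independent family $(x_1,\dots,x_{kn})\subset\mathcal{X}$ and any family $(y_1,\dots,y_n)\subset\mathcal{X}$, there are $j_1,\dots,j_n\in\{1,\dots,kn\}$ and $T\in\mathcal{A}$ with $\|y_i-Tx_{j_i}\|<\varepsilon$ for $1\le i\le n$. *)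

theory Defs
  imports "HOL-Analysis.Analysis"
begin

definition infinite_dimensional :: "'a::real_vector itself \<Rightarrow> bool" where
  "infinite_dimensional _ \<longleftrightarrow> \<not> (\<exists>B :: 'a set. finite B \<and> span B = UNIV)"

definition operator_algebra :: "('a::real_normed_vector \<Rightarrow>\<^sub>L 'a) set \<Rightarrow> bool" where
  "operator_algebra A \<longleftrightarrow> subspace A \<and> (\<forall>S\<in>A. \<forall>T\<in>A. S o\<^sub>L T \<in> A)"

definition transitive_algebra :: "('a::real_normed_vector \<Rightarrow>\<^sub>L 'a) set \<Rightarrow> bool" where
  "transitive_algebra A \<longleftrightarrow> operator_algebra A \<and>
     (\<forall>\<epsilon>>0. \<forall>x y. x \<noteq> 0 \<longrightarrow> (\<exists>T\<in>A. norm (blinfun_apply T x - y) < \<epsilon>))"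

definition finite_rank :: "('a::real_normed_vector \<Rightarrow>\<^sub>L 'b::real_normed_vector) \<Rightarrow> bool" where
  "finite_rank T \<longleftrightarrow> (\<exists>B. finite B \<and> range (blinfun_apply T) = span B)"

definition L_algebra :: "('a::real_normed_vector \<Rightarrow>\<^sub>L 'a) set \<Rightarrow> bool" where
  "L_algebra A \<longleftrightarrow> transitive_algebra A \<and> (\<exists>T\<in>A. T \<noteq> 0 \<and> finite_rank T)"

text \<open>For families, as opposed to sets, linear independence also excludes repetitions.\<close>

definition independent_family :: "(nat \<Rightarrow> 'a::real_vector) \<Rightarrow> nat set \<Rightarrow> bool" where
  "independent_family x I \<longleftrightarrow> inj_on x I \<and> independent (x ` I)"

text \<open>\<open>one_over_dense k A\<close> says that \<open>A\<close> is $(1/k)$-dense. The indices \<open>j i\<close> are not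
  required to be distinct.\<close>

definition one_over_dense :: "nat \<Rightarrow> ('a::real_normed_vector \<Rightarrow>\<^sub>L 'a) set \<Rightarrow> bool" where
  "one_over_dense k A \<longleftrightarrow>
     (\<forall>\<epsilon>>0. \<forall>n\<ge>1. \<forall>x y :: nat \<Rightarrow> 'a. independent_family x {1..k * n} \<longrightarrow>
        (\<exists>j :: nat \<Rightarrow> nat. (\<forall>i\<in>{1..n}. j i \<in> {1..k * n}) \<and>
           (\<exists>T\<in>A. \<forall>i\<in>{1..n}. norm (y i - blinfun_apply T (x (j i))) < \<epsilon>)))"

end

theory Submission
  imports Defs "HOL-Computational_Algebra.Fundamental_Theorem_Algebra"
begin

text \<open>
  Why the theorem holds. Let \<open>F\<close> be a non-zero operator of least rank in the \<open>L\<close>-algebra \<open>A\<close>, let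
  \<open>V\<close> be its range, and let \<open>W\<close> be the set of operators in \<open>A\<close> whose range lies in \<open>V\<close>. Two facts
  about \<open>W\<close> make everything work. An operator in \<open>W\<close> that kills one non-zero vector of \<open>V\<close> is zero
  on all of \<open>V\<close>, for otherwise composing it with \<open>F\<close> would give a smaller rank
  (\<open>W_eq_0_on_span\<close>). And for every \<open>x \<noteq> 0\<close> the orbit \<open>{w x | w. w \<in> W}\<close> is exactly \<open>V\<close>: by
  transitivity it is dense in \<open>V\<close>, and a subspace of a finite-dimensional space is closed
  (\<open>W_onto\<close>).

  Hence \<open>W\<close> contains an idempotent \<open>e\<close> onto \<open>V\<close>, and \<open>D = {w \<in> W. w e = w}\<close>, the corner \<open>e A e\<close>,
  is a real division algebra with unit \<open>e\<close> for which evaluation at any non-zero \<open>v \<in> V\<close> is a linear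
  bijection from \<open>D\<close> onto \<open>V\<close>. The theorem of Frobenius bounds the dimension of \<open>D\<close>, and so that of
  \<open>V\<close>, by 4 (\<open>frobenius_dimension\<close>, \<open>minimal_range_le_4\<close>). This is where the number 4 comes from.

  Now let \<open>x\<^sub>i\<close>, \<open>i \<in> I\<close>, be linearly independent and fix a non-zero \<open>v \<in> V\<close>. Choose \<open>J \<subseteq> I\<close> as large
  as possible such that there are \<open>w\<^sub>j \<in> W\<close>, \<open>j \<in> J\<close>, with \<open>w\<^sub>j x\<^sub>j = v\<close> and \<open>w\<^sub>j x\<^sub>l = 0\<close> for the other
  \<open>l \<in> J\<close>. By maximality, an operator in \<open>W\<close> that kills all \<open>x\<^sub>j\<close>, \<open>j \<in> J\<close>, kills all \<open>x\<^sub>i\<close>. From this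
  one finds that a vector in the span of the \<open>x\<^sub>i\<close> on which all \<open>w\<^sub>j\<close> vanish is killed by all of
  \<open>W\<close>, hence is zero. So \<open>x \<mapsto> (w\<^sub>j x)\<^sub>j\<close> is an injection from the span of the \<open>x\<^sub>i\<close> into the space of
  families in \<open>V\<close> indexed by \<open>J\<close>, and \<open>card I \<le> 4 * card J\<close> (\<open>large_dual_system\<close>). With
  \<open>card I = 4 n\<close> there are at least \<open>n\<close> indices in \<open>J\<close>; picking \<open>S\<^sub>i \<in> A\<close> with \<open>S\<^sub>i v\<close> close to
  \<open>y\<^sub>i\<close>, the operator \<open>\<Sum>\<^sub>i S\<^sub>i w\<^bsub>j i\<^esub>\<close> of \<open>A\<close> does what is required.
\<close>

section \<open>Finite-dimensional subspaces of normed spaces are closed\<close>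

text \<open>
  Modulo the closed subspace \<open>U\<close>, the vector \<open>a\<close> has positive norm \<open>d\<close>; hence the coefficients of \<open>a\<close>
  along a convergent sequence in the larger space form a Cauchy sequence of reals, and subtracting
  their limit leads back to \<open>U\<close>.
\<close>

lemma closed_insert_span:
  fixes U :: "'a::real_normed_vector set"
  assumes "subspace U" "closed U"
  shows "closed (span (insert a U))"
proof (cases "a \<in> U")
  case True
  then show ?thesis using assms by (simp add: insert_absorb span_eq_iff[THEN iffD2])
next
  case False
  have sp: "span U = U" using assms(1) by simp
  obtain d where d: "d > 0" "\<And>u. u \<in> U \<Longrightarrow> d \<le> norm (a - u)"
  proof -
    have "open (- U)" "a \<in> - U" using assms(2) False by auto
    then obtain d where "d > 0" "ball a d \<subseteq> - U" by (meson open_contains_ball)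
    then show ?thesis using that by (force simp: dist_norm)
  qed
  have coeff: "\<bar>t\<bar> * d \<le> norm (t *\<^sub>R a + u)" if "u \<in> U" for t u
  proof (cases "t = 0")
    case False
    have "- (inverse t *\<^sub>R u) \<in> U"
      using that assms(1) by (simp add: subspace_neg subspace_scale)
    from d(2)[OF this] have "\<bar>t\<bar> * d \<le> \<bar>t\<bar> * norm (a + inverse t *\<^sub>R u)"
      by (simp add: mult_left_mono)
    also have "\<dots> = norm (t *\<^sub>R (a + inverse t *\<^sub>R u))" by simp
    finally show ?thesis using False by (simp add: scaleR_add_right)
  qed simp
  show ?thesis unfolding closed_sequential_limits
  proof (intro allI impI, elim conjE)
    fix y l assume y: "\<forall>n. y n \<in> span (insert a U)" and lim: "y \<longlonglongrightarrow> l"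
    have "\<forall>n. \<exists>k. y n - k *\<^sub>R a \<in> U" using y by (auto simp: span_insert sp)
    then obtain k where k: "\<And>n. y n - k n *\<^sub>R a \<in> U" by metis
    have "Cauchy k" unfolding Cauchy_def
    proof (intro allI impI)
      fix \<epsilon> :: real assume "\<epsilon> > 0"
      then obtain M where M: "\<And>m n. m \<ge> M \<Longrightarrow> n \<ge> M \<Longrightarrow> dist (y m) (y n) < \<epsilon> * d"
        using LIMSEQ_imp_Cauchy[OF lim] d(1) unfolding Cauchy_def by (meson mult_pos_pos)
      have "dist (k m) (k n) < \<epsilon>" if "m \<ge> M" "n \<ge> M" for m n
      proof -
        have "(y m - k m *\<^sub>R a) - (y n - k n *\<^sub>R a) \<in> U"
          using k assms(1) subspace_diff by blast
        from coeff[OF this, of "k m - k n"]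
        have "\<bar>k m - k n\<bar> * d \<le> dist (y m) (y n)" by (simp add: dist_norm algebra_simps)
        also have "\<dots> < \<epsilon> * d" using M that by blast
        finally show ?thesis using d(1) by (simp add: dist_norm)
      qed
      then show "\<exists>M. \<forall>m\<ge>M. \<forall>n\<ge>M. dist (k m) (k n) < \<epsilon>" by blast
    qed
    then obtain c where "k \<longlonglongrightarrow> c" using Cauchy_convergent_iff convergent_def by blast
    then have "(\<lambda>n. y n - k n *\<^sub>R a) \<longlonglongrightarrow> l - c *\<^sub>R a" by (intro tendsto_intros lim)
    then have "l - c *\<^sub>R a \<in> U" using k assms(2) by (meson closed_sequentially)
    then show "l \<in> span (insert a U)" by (auto simp: span_insert sp)
  qed
qed

lemma closed_finite_span:
  fixes B :: "'a::real_normed_vector set"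
  assumes "finite B"
  shows "closed (span B)"
  using assms
proof induction
  case (insert a B)
  have "span (insert a (span B)) = span (insert a B)"
    by (simp add: span_insert span_span)
  then show ?case using closed_insert_span[OF subspace_span insert.IH, of a] by simp
qed simp

lemma closed_finite_dim_subspace:
  fixes U :: "'a::real_normed_vector set"
  assumes "subspace U" "U \<subseteq> span B" "finite B"
  shows "closed U"
proof -
  obtain C where C: "C \<subseteq> U" "independent C" "U \<subseteq> span C"
    using maximal_independent_subset by blast
  have "finite C" using independent_span_bound[OF assms(3) C(2)] C(1) assms(2) by blast
  moreover have "span C = U" using C assms(1) span_subspace by blast
  ultimately show ?thesis using closed_finite_span by metis
qed

section \<open>Counting in kernels of linear maps\<close>

lemma independent_span_Int:
  assumes "independent (A \<union> B)" "A \<inter> B = {}"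
  shows "span A \<inter> span B = {0}"
proof -
  have "x = 0" if x: "x \<in> span A" "x \<in> span B" for x
  proof -
    have "representation A x = representation B x"
      using representation_extend[OF assms(1) x(1)] representation_extend[OF assms(1) x(2)] by simp
    then have "{v. representation A x v \<noteq> 0} = {}"
      using representation_ne_zero[of A x] representation_ne_zero[of B x] assms(2) by auto
    then show ?thesis
      using sum_nonzero_representation_eq[of A x] x(1) independent_mono[OF assms(1)] by simp
  qed
  then show ?thesis using span_zero by blast
qed

text \<open>
  Rank-nullity for a map into a space of dimension at most \<open>card Q\<close>, phrased with independent sets so
  that it can be iterated without finite-dimensionality of the ambient space: extend a basis \<open>S'\<close> of
  the kernel to a basis of \<open>span S\<close>; the map is injective on the span of the added vectors.
\<close>

lemma independent_in_kernel:
  fixes w :: "'a::real_vector \<Rightarrow> 'b::real_vector"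
  assumes "linear w" "finite S" "independent S" "finite Q" "w ` span S \<subseteq> span Q"
  shows "\<exists>S'. finite S' \<and> independent S' \<and> S' \<subseteq> span S \<and> (\<forall>x\<in>S'. w x = 0) \<and> card S \<le> card S' + card Q"
proof -
  let ?K = "{x \<in> span S. w x = 0}"
  obtain S' where S': "S' \<subseteq> ?K" "independent S'" "?K \<subseteq> span S'"
    using maximal_independent_subset by blast
  obtain C where C: "S' \<subseteq> C" "C \<subseteq> span S" "independent C" "span S \<subseteq> span C"
    using maximal_independent_subset_extend[of S' "span S"] S' by blast
  have finC: "finite C" using independent_span_bound[OF assms(2) C(3,2)] by blast
  have "card S \<le> card C"
    using independent_span_bound[OF finC assms(3)] C(4) span_superset by blast
  have inj: "inj_on w (span (C - S'))"
  proof (subst linear_inj_on_iff_eq_0[OF assms(1)], simp, intro ballI impI)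
    fix x assume x: "x \<in> span (C - S')" "w x = 0"
    have "span (C - S') \<subseteq> span S" using C(2) by (meson Diff_subset span_minimal subset_trans subspace_span)
    then have "x \<in> span S'" using x S'(3) by blast
    with x(1) have "x \<in> span (C - S') \<inter> span S'" by blast
    also have "\<dots> = {0}"
      by (rule independent_span_Int) (use C in \<open>auto simp: Un_absorb2\<close>)
    finally show "x = 0" by simp
  qed
  have "independent (w ` (C - S'))"
    using linear_independent_injective_image[OF assms(1) _ inj] C(3) independent_mono by blast
  moreover have "w ` (C - S') \<subseteq> span Q" using C(2) assms(5) by blast
  ultimately have "card (w ` (C - S')) \<le> card Q"
    using independent_span_bound[OF assms(4)] by blast
  moreover have "card (w ` (C - S')) = card (C - S')"
    using inj card_image inj_on_subset span_superset by metis
  moreover have "card C = card S' + card (C - S')"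
    using finC C(1) by (metis card_Diff_subset card_mono finite_subset le_add_diff_inverse)
  ultimately show ?thesis using \<open>card S \<le> card C\<close> S' C(1) finC
    by (intro exI[of _ S']) (auto intro: finite_subset)
qed

lemma common_kernel_vector:
  fixes w :: "'i \<Rightarrow> 'a::real_vector \<Rightarrow> 'b::real_vector"
  assumes "finite I" "finite Q" "\<And>i. i \<in> I \<Longrightarrow> linear (w i)"
    and "finite S" "independent S" "card I * card Q < card S"
    and "\<And>i x. i \<in> I \<Longrightarrow> x \<in> span S \<Longrightarrow> w i x \<in> span Q"
  shows "\<exists>x\<in>span S. x \<noteq> 0 \<and> (\<forall>i\<in>I. w i x = 0)"
  using assms(1,3-)
proof (induction I arbitrary: S rule: finite_induct)
  case empty
  have "S \<noteq> {}" using empty.prems(4) by auto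
  then obtain x where "x \<in> S" by blast
  then have "x \<in> span S" "x \<noteq> 0"
    using empty.prems(3) dependent_zero span_base by metis+
  then show ?case by blast
next
  case (insert i I)
  obtain S' where S': "finite S'" "independent S'" "S' \<subseteq> span S" "\<forall>x\<in>S'. w i x = 0"
      "card S \<le> card S' + card Q"
    using independent_in_kernel[of "w i" S Q] insert.prems assms(2) by auto
  have sub: "span S' \<subseteq> span S" using S'(3) by (simp add: span_minimal)
  have "\<exists>x\<in>span S'. x \<noteq> 0 \<and> (\<forall>i\<in>I. w i x = 0)"
    using insert.prems insert.hyps S' sub by (intro insert.IH) auto
  then obtain x where x: "x \<in> span S'" "x \<noteq> 0" "\<forall>i\<in>I. w i x = 0" by blast
  moreover have "w i x = 0"
    using linear_eq_0_on_span[of "w i" S' x] insert.prems S'(4) x(1) by auto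
  ultimately show ?case using sub by blast
qed

text \<open>
  Indexing by natural numbers, rather than by a set of vectors, also covers sequences with
  repetitions; the powers of an algebra element are such a sequence.
\<close>

lemma dependent_sequence_combination:
  fixes f :: "nat \<Rightarrow> 'a::real_vector"
  assumes "finite B" "\<And>k. f k \<in> span B"
  shows "\<exists>c. (\<exists>k\<le>card B. c k \<noteq> 0) \<and> (\<Sum>k\<le>card B. c k *\<^sub>R f k) = 0"
proof (cases "inj_on f {..card B}")
  case True
  have "card (f ` {..card B}) = Suc (card B)" using True by (simp add: card_image)
  then have "dependent (f ` {..card B})"
    using independent_span_bound[OF assms(1), of "f ` {..card B}"] assms(2) by fastforce
  then obtain u v where u: "v \<in> f ` {..card B}" "u v \<noteq> 0" "(\<Sum>v\<in>f ` {..card B}. u v *\<^sub>R v) = 0"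
    by (auto simp: dependent_finite)
  then show ?thesis
    by (intro exI[of _ "\<lambda>k. u (f k)"]) (auto simp: sum.reindex[OF True])
next
  case False
  then obtain i j where ij: "i \<le> card B" "j \<le> card B" "i \<noteq> j" "f i = f j"
    by (auto simp: inj_on_def)
  \<comment> \<open>The difference of two equal terms of the sequence.\<close>
  let ?c = "\<lambda>k. (if k = i then 1 else 0) - (if k = j then 1 else 0 :: real)"
  have "(\<Sum>k\<le>card B. ?c k *\<^sub>R f k)
      = (\<Sum>k\<le>card B. if k = i then f k else 0) - (\<Sum>k\<le>card B. if k = j then f k else 0)"
    by (simp add: scaleR_left_diff_distrib sum_subtractf if_distrib[of "\<lambda>t. t *\<^sub>R _"] cong: if_cong)
  also have "\<dots> = 0" using ij by (simp add: sum.delta)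
  finally show ?thesis using ij by (intro exI[of _ ?c]) auto
qed

section \<open>Real polynomials in a linear map\<close>

text \<open>
  The value at \<open>v\<close> of the operator \<open>p(f)\<close>. It is a vector rather than an operator, so that it
  makes sense for every linear \<open>f\<close> and every real vector space, in particular for multiplication
  by a complex number on the complex plane.
\<close>

definition poly_act :: "real poly \<Rightarrow> ('a::real_vector \<Rightarrow> 'a) \<Rightarrow> 'a \<Rightarrow> 'a" where
  "poly_act p f v = (\<Sum>i\<le>degree p. coeff p i *\<^sub>R (f ^^ i) v)"

lemma poly_act_0 [simp]: "poly_act 0 f v = 0"
  by (simp add: poly_act_def)

lemma poly_act_pCons [simp]:
  assumes "linear f"
  shows "poly_act (pCons a p) f v = a *\<^sub>R v + f (poly_act p f v)"
proof (cases "p = 0")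
  case False
  then show ?thesis
    by (simp add: poly_act_def sum.atMost_Suc_shift linear_sum[OF assms] linear_scale[OF assms]
        del: sum.atMost_Suc)
qed (use assms in \<open>auto simp: poly_act_def linear_0\<close>)

lemma poly_act_add:
  assumes "linear f"
  shows "poly_act (p + q) f v = poly_act p f v + poly_act q f v"
  by (induction p q rule: poly_induct2)
    (simp_all add: assms linear_add[OF assms] scaleR_left_distrib)

lemma poly_act_smult:
  assumes "linear f"
  shows "poly_act (smult a p) f v = a *\<^sub>R poly_act p f v"
  by (induction p) (simp_all add: assms linear_scale[OF assms] scaleR_right_distrib)

lemma poly_act_mult:
  assumes "linear f"
  shows "poly_act (p * q) f v = poly_act p f (poly_act q f v)"
  by (induction p) (simp_all add: assms poly_act_add poly_act_smult mult_pCons_left)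

lemma poly_act_zero:
  assumes "linear f"
  shows "poly_act p f 0 = 0"
  by (induction p) (simp_all add: assms linear_0[OF assms])

lemma poly_act_mod:
  assumes "linear f" "poly_act m f v = 0"
  shows "poly_act (p mod m) f v = poly_act p f v"
proof -
  have "poly_act p f v = poly_act (p div m * m + p mod m) f v"
    by (simp only: div_mult_mod_eq)
  also have "\<dots> = poly_act (p div m) f (poly_act m f v) + poly_act (p mod m) f v"
    by (simp only: poly_act_add[OF assms(1)] poly_act_mult[OF assms(1)])
  also have "\<dots> = poly_act (p mod m) f v"
    by (simp add: assms(2) poly_act_zero[OF assms(1)])
  finally show ?thesis by simp
qed

text \<open>
  A complex root \<open>z\<close> of \<open>p\<close> is a root of \<open>X - s\<close> or of \<open>(X - s)\<^sup>2 + t\<^sup>2\<close>, where \<open>z = s + i t\<close>. The remainder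
  of \<open>p\<close> modulo that polynomial has smaller degree and still vanishes at \<open>z\<close>, so it is zero. Real
  polynomials are evaluated at \<open>z\<close> by letting them act through multiplication by \<open>z\<close>.
\<close>

lemma real_poly_factor:
  fixes p :: "real poly"
  assumes "degree p > 0"
  shows "\<exists>s t. [:-s, 1:] dvd p \<or> [:s\<^sup>2 + t\<^sup>2, -2 * s, 1:] dvd p"
proof -
  have lin: "linear ((*) z)" for z :: complex by (auto intro!: linearI simp: algebra_simps)
  have ev: "poly_act q ((*) z) 1 = poly (map_poly of_real q) z" for q and z :: complex
  proof (induction q)
    case (pCons a q)
    then show ?case by (simp add: lin map_poly_pCons scaleR_conv_of_real)
  qed simp
  have "degree (map_poly complex_of_real p) > 0"
    using assms by (simp add: degree_map_poly)
  then have "\<not> constant (poly (map_poly complex_of_real p))"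
    by (simp add: constant_degree)
  then obtain z where z: "poly_act p ((*) z) (1::complex) = 0"
    using fundamental_theorem_of_algebra ev by metis
  show ?thesis
  proof (cases "Im z = 0")
    case True
    let ?m = "[:- Re z, 1:]"
    have m0: "poly_act ?m ((*) z) 1 = 0" using True by (simp add: lin complex_eq_iff)
    have "poly_act (p mod ?m) ((*) z) (1::complex) = 0"
      using z m0 by (simp only: poly_act_mod[OF lin])
    moreover have "degree (p mod ?m) < 1"
      using degree_mod_less[of ?m p] by (auto)
    then obtain c where c: "p mod ?m = [:c:]" using degree_eq_zeroE by blast
    ultimately have "p mod ?m = 0" by (simp add: c lin)
    then show ?thesis by blast
  next
    case False
    let ?m = "[:(Re z)\<^sup>2 + (Im z)\<^sup>2, -2 * Re z, 1:]"
    have m0: "poly_act ?m ((*) z) 1 = 0"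
      by (simp add: lin complex_eq_iff power2_eq_square algebra_simps)
    have "poly_act (p mod ?m) ((*) z) (1::complex) = 0"
      using z m0 by (simp only: poly_act_mod[OF lin])
    moreover have "degree (p mod ?m) < 2"
      using degree_mod_less[of ?m p] by (auto)
    then have "p mod ?m = [:coeff (p mod ?m) 0, coeff (p mod ?m) 1:]"
      by (intro poly_eqI) (auto simp: coeff_pCons coeff_eq_0 split: nat.split)
    then obtain c d where c: "p mod ?m = [:c, d:]" by blast
    ultimately have "p mod ?m = 0" using False by (auto simp: c lin complex_eq_iff)
    then show ?thesis by blast
  qed
qed

text \<open>
  The upper limit \<open>N\<close> makes it possible to evaluate a polynomial whose exact degree is unknown.
\<close>

lemma poly_act_eq_sum:
  assumes "degree p \<le> N"
  shows "poly_act p f v = (\<Sum>i\<le>N. coeff p i *\<^sub>R (f ^^ i) v)"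
  unfolding poly_act_def using assms
  by (intro sum.mono_neutral_left) (auto simp: coeff_eq_0)

section \<open>Real division algebras have dimension at most four\<close>

text \<open>
  The algebra is a subset \<open>D\<close> of an ambient algebra whose unit may differ from the unit \<open>e\<close> of \<open>D\<close>:
  the intended instance is a corner \<open>e A e\<close> in an algebra of operators. The case \<open>D = {0}\<close>, \<open>e = 0\<close>
  is included.
\<close>

locale finite_dim_division_algebra =
  fixes mult :: "'v::real_vector \<Rightarrow> 'v \<Rightarrow> 'v" (infixl "\<odot>" 70)
    and D :: "'v set" and e :: 'v and B :: "'v set"
  assumes bilinear: "bilinear (\<odot>)"
    and assoc: "x \<odot> y \<odot> z = x \<odot> (y \<odot> z)"
    and subspace_D: "subspace D"
    and closed: "x \<in> D \<Longrightarrow> y \<in> D \<Longrightarrow> x \<odot> y \<in> D"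
    and unit_in: "e \<in> D"
    and unit_left [simp]: "x \<in> D \<Longrightarrow> e \<odot> x = x"
    and unit_right [simp]: "x \<in> D \<Longrightarrow> x \<odot> e = x"
    and no_zero_divisors: "x \<in> D \<Longrightarrow> y \<in> D \<Longrightarrow> x \<odot> y = 0 \<Longrightarrow> x = 0 \<or> y = 0"
    and finite_dim: "finite B" "D \<subseteq> span B"
begin

lemmas distribs = bilinear_ladd[OF bilinear] bilinear_radd[OF bilinear]
  bilinear_lsub[OF bilinear] bilinear_rsub[OF bilinear]
  bilinear_lmul[OF bilinear] bilinear_rmul[OF bilinear]
  bilinear_lneg[OF bilinear] bilinear_rneg[OF bilinear]
  bilinear_lzero[OF bilinear] bilinear_rzero[OF bilinear]

lemmas D_closed = closed unit_in subspace_add[OF subspace_D] subspace_diff[OF subspace_D]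
  subspace_scale[OF subspace_D] subspace_neg[OF subspace_D] subspace_0[OF subspace_D]

lemma scaleR_double: "(s * 2) *\<^sub>R (v::'v) = s *\<^sub>R v + s *\<^sub>R v"
  by (metis mult_2_right scaleR_left_distrib)

lemma linear_mult: "linear ((\<odot>) x)"
  using bilinear by (simp add: bilinear_def)

lemma poly_act_in: "x \<in> D \<Longrightarrow> poly_act p ((\<odot>) x) e \<in> D"
  by (induction p) (auto simp: linear_mult intro!: D_closed)

lemma annihilating_poly:
  assumes "x \<in> D"
  shows "\<exists>p. p \<noteq> 0 \<and> poly_act p ((\<odot>) x) e = 0"
proof -
  have "((\<odot>) x ^^ k) e \<in> D" for k
    by (induction k) (auto intro: D_closed assms)
  then obtain c k where c: "k \<le> card B" "c k \<noteq> 0"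
      "(\<Sum>k\<le>card B. c k *\<^sub>R ((\<odot>) x ^^ k) e) = 0"
    using dependent_sequence_combination[of B "\<lambda>k. ((\<odot>) x ^^ k) e"] finite_dim by blast
  define p where "p = (\<Sum>k\<le>card B. monom (c k) k)"
  have coeff: "coeff p k = (if k \<le> card B then c k else 0)" for k
    by (simp add: p_def coeff_sum)
  then have "degree p \<le> card B" by (intro degree_le) auto
  then have "poly_act p ((\<odot>) x) e = 0" using c(3) by (simp add: poly_act_eq_sum coeff)
  moreover have "p \<noteq> 0" using c(1,2) coeff[of k] by auto
  ultimately show ?thesis by blast
qed

text \<open>
  A polynomial that annihilates \<open>x\<close> has a factor \<open>X - s\<close> or \<open>(X - s)\<^sup>2 + t\<^sup>2\<close>. Since there are no zero
  divisors, \<open>x\<close> is annihilated by that factor or by the cofactor, which has smaller degree. The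
  linear case is the conclusion with \<open>t = 0\<close>.
\<close>

lemma square_shift:
  assumes "x \<in> D"
  obtains s t where "(x - s *\<^sub>R e) \<odot> (x - s *\<^sub>R e) = - (t\<^sup>2) *\<^sub>R e"
proof -
  have "\<exists>s t. (x - s *\<^sub>R e) \<odot> (x - s *\<^sub>R e) = - (t\<^sup>2) *\<^sub>R e"
    if "p \<noteq> 0" "poly_act p ((\<odot>) x) e = 0" for p
    using that
  proof (induction "degree p" arbitrary: p rule: less_induct)
    case less
    show ?case
    proof (cases "degree p = 0")
      case True
      then obtain c where "p = [:c:]" by (rule degree_eq_zeroE)
      then have "e = 0" using less.prems by (simp add: linear_mult linear_0[OF linear_mult])
      then show ?thesis using unit_right[OF assms] by (auto simp: distribs)
    next
      case False
      then obtain s t m where m: "m dvd p" "degree m > 0"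
        "m = [:-s, 1:] \<or> m = [:s\<^sup>2 + t\<^sup>2, -2 * s, 1:]"
        using real_poly_factor[of p] by (metis degree_pCons_eq_if gr0I nat.distinct(1) one_neq_zero pCons_eq_0_iff)
      obtain q where q: "p = m * q" using m(1) by (rule dvdE)
      define u where "u = poly_act q ((\<odot>) x) e"
      have u: "u \<in> D" by (simp add: u_def poly_act_in assms)
      have mu: "poly_act m ((\<odot>) x) u = 0"
        using less.prems by (simp add: q u_def poly_act_mult linear_mult)
      show ?thesis
      proof (cases "u = 0")
        case True
        have "m \<noteq> 0" "q \<noteq> 0" using q less.prems by auto
        then have "degree q < degree p" using m(2) by (simp add: q degree_mult_eq)
        then show ?thesis using less.hyps[of q] True \<open>q \<noteq> 0\<close> by (simp add: u_def)
      next
        case False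
        from m(3) show ?thesis
        proof
          assume "m = [:-s, 1:]"
          then have "(x - s *\<^sub>R e) \<odot> u = 0"
            using mu u by (simp add: linear_mult distribs)
          then have "x - s *\<^sub>R e = 0"
            using no_zero_divisors False u assms by (meson D_closed)
          then show ?thesis by (intro exI[of _ s] exI[of _ 0]) (simp add: distribs)
        next
          assume "m = [:s\<^sup>2 + t\<^sup>2, -2 * s, 1:]"
          then have "((x - s *\<^sub>R e) \<odot> (x - s *\<^sub>R e) + (t\<^sup>2) *\<^sub>R e) \<odot> u = 0"
            using mu u assms by (simp add: linear_mult distribs assoc D_closed algebra_simps power2_eq_square scaleR_double)
          then have "(x - s *\<^sub>R e) \<odot> (x - s *\<^sub>R e) + (t\<^sup>2) *\<^sub>R e = 0"
            using no_zero_divisors False u assms by (meson D_closed)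
          then show ?thesis by (intro exI[of _ s] exI[of _ t]) (simp add: eq_neg_iff_add_eq_0)
        qed
      qed
    qed
  qed
  then show thesis using annihilating_poly[OF assms] that by blast
qed

text \<open>
  Rescaling \<open>x - s e\<close> by \<open>1 / t\<close>: every element generates a copy of the reals or of the complex
  numbers.
\<close>

lemma scalar_or_imaginary:
  assumes "x \<in> D"
  obtains s where "x = s *\<^sub>R e"
  | s t y where "t \<noteq> 0" "y \<in> D" "y \<odot> y = - e" "x = s *\<^sub>R e + t *\<^sub>R y"
proof -
  obtain s t where st: "(x - s *\<^sub>R e) \<odot> (x - s *\<^sub>R e) = - (t\<^sup>2) *\<^sub>R e"
    using square_shift[OF assms] .
  have D: "x - s *\<^sub>R e \<in> D" by (intro D_closed assms)
  show thesis
  proof (cases "t = 0")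
    case True
    then have "x - s *\<^sub>R e = 0" using st no_zero_divisors[OF D D] by simp
    then show ?thesis using that(1)[of s] by simp
  next
    case False
    define y where "y = inverse t *\<^sub>R (x - s *\<^sub>R e)"
    have "y \<odot> y = (inverse t * inverse t) *\<^sub>R ((x - s *\<^sub>R e) \<odot> (x - s *\<^sub>R e))"
      unfolding y_def by (simp only: bilinear_lmul[OF bilinear] bilinear_rmul[OF bilinear] scaleR_scaleR)
    also have "\<dots> = - e" using False by (simp add: st power2_eq_square field_simps)
    finally have "y \<odot> y = - e" .
    moreover have "y \<in> D" unfolding y_def by (intro D_closed assms)
    moreover have "x = s *\<^sub>R e + t *\<^sub>R y" using False by (simp add: y_def)
    ultimately show ?thesis using that(2) False by blast
  qed
qed

text \<open>
  The centraliser of an imaginary unit \<open>i\<close> is the copy of the complex numbers spanned by \<open>e\<close> and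
  \<open>i\<close>: another imaginary unit \<open>y\<close> commuting with \<open>i\<close> satisfies \<open>(y - i)(y + i) = 0\<close>.
\<close>

lemma commuting_with_imaginary:
  assumes i: "i \<in> D" "i \<odot> i = - e" and x: "x \<in> D" "i \<odot> x = x \<odot> i"
  obtains a b where "x = a *\<^sub>R e + b *\<^sub>R i"
  using x(1)
proof (cases rule: scalar_or_imaginary)
  case (1 s)
  then show ?thesis using that[of s 0] by simp
next
  case (2 s t y)
  have "t *\<^sub>R (i \<odot> y) = t *\<^sub>R (y \<odot> i)" using x(2) i by (simp add: 2 distribs)
  then have "i \<odot> y = y \<odot> i" using 2(1) by simp
  then have "(y - i) \<odot> (y + i) = 0" using 2 i by (simp add: distribs)
  then have "y = i \<or> y = - i"
    using no_zero_divisors[of "y - i" "y + i"] 2(2) i(1) D_closed(3,4)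
    by (auto simp: eq_neg_iff_add_eq_0)
  then show ?thesis using that[of s t] that[of s "- t"] 2(4) by auto
qed

text \<open>
  The quadratic equation \<open>j\<^sup>2 = 2 s j + c e\<close> has no linear term, because \<open>i\<close> commutes with \<open>j\<^sup>2\<close> and
  with \<open>e\<close> but not with \<open>j\<close>.
\<close>

lemma anticommuting_square:
  assumes i: "i \<in> D" "i \<odot> i = - e" and j: "j \<in> D" "j \<noteq> 0" "i \<odot> j = - (j \<odot> i)"
  obtains c where "c \<noteq> 0" "j \<odot> j = c *\<^sub>R e"
proof -
  obtain s t where "(j - s *\<^sub>R e) \<odot> (j - s *\<^sub>R e) = - (t\<^sup>2) *\<^sub>R e"
    using square_shift[OF j(1)] .
  then have "j \<odot> j - s *\<^sub>R j - s *\<^sub>R j + s\<^sup>2 *\<^sub>R e = - (t\<^sup>2) *\<^sub>R e"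
    using j(1) unit_in by (simp add: distribs power2_eq_square algebra_simps)
  then have "j \<odot> j = (s + s) *\<^sub>R j + (- (t\<^sup>2) - s\<^sup>2) *\<^sub>R e"
    by (simp add: algebra_simps scaleR_double)
  then obtain c where jj: "j \<odot> j = (s + s) *\<^sub>R j + c *\<^sub>R e" by blast
  have "i \<odot> (j \<odot> j) = (j \<odot> j) \<odot> i"
    by (simp add: assoc[symmetric] j(3) distribs) (simp add: assoc j(3) distribs)
  then have "s = 0 \<or> i \<odot> j = j \<odot> i"
    using i(1) by (auto simp: jj distribs)
  moreover have "i \<odot> j \<noteq> j \<odot> i"
  proof
    assume "i \<odot> j = j \<odot> i"
    with j(3) have "i \<odot> j = - (i \<odot> j)" by simp
    then have "2 *\<^sub>R (i \<odot> j) = 0" by (simp only: scaleR_2 eq_neg_iff_add_eq_0)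
    then have "i \<odot> j = 0" by simp
    then have "i = 0" using no_zero_divisors[OF i(1) j(1)] j(2) by blast
    then show False using i(2) unit_right[OF j(1)] j(2) by (simp add: distribs)
  qed
  ultimately have "j \<odot> j = c *\<^sub>R e" using jj by simp
  moreover have "c \<noteq> 0" using calculation no_zero_divisors[OF j(1) j(1)] j(2) by auto
  ultimately show ?thesis using that by blast
qed

text \<open>
  Conjugation by an imaginary unit \<open>i\<close> splits \<open>D\<close> into the elements that commute and those that
  anticommute with \<open>i\<close>. The former are spanned by \<open>e\<close> and \<open>i\<close>. If \<open>j \<noteq> 0\<close> is one of the latter, right
  multiplication by \<open>j\<close> maps them to the former, and it is inverted by multiplying by \<open>j\<close> again, up to
  a scalar; so they are spanned by \<open>j\<close> and \<open>i j\<close>.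
\<close>

theorem frobenius_dimension:
  "\<exists>Q. finite Q \<and> card Q \<le> 4 \<and> D \<subseteq> span Q"
proof (cases "\<exists>i\<in>D. i \<odot> i = - e")
  case False
  then have "D \<subseteq> span {e}"
    by (metis scalar_or_imaginary span_base span_scale singletonI subsetI)
  then show ?thesis by (intro exI[of _ "{e}"]) auto
next
  case True
  then obtain i where i: "i \<in> D" "i \<odot> i = - e" by blast
  have ii: "i \<odot> (i \<odot> x) = - x" if "x \<in> D" for x
    using that i by (simp add: assoc[symmetric] distribs)
  \<comment> \<open>If only 0 anticommutes with \<open>i\<close>, then \<open>j = 0\<close> serves.\<close>
  have "\<exists>j\<in>D. \<forall>z\<in>D. i \<odot> z = - (z \<odot> i) \<longrightarrow> (\<exists>a b. z = a *\<^sub>R j + b *\<^sub>R (i \<odot> j))"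
  proof (cases "\<exists>j\<in>D. j \<noteq> 0 \<and> i \<odot> j = - (j \<odot> i)")
    case False
    then show ?thesis using subspace_0[OF subspace_D]
      by (intro bexI[of _ 0]) (auto simp: distribs)
  next
    case True
    then obtain j where j: "j \<in> D" "j \<noteq> 0" "i \<odot> j = - (j \<odot> i)" by blast
    obtain c where c: "c \<noteq> 0" "j \<odot> j = c *\<^sub>R e" using anticommuting_square[OF i j] .
    have "\<exists>a b. z = a *\<^sub>R j + b *\<^sub>R (i \<odot> j)" if z: "z \<in> D" "i \<odot> z = - (z \<odot> i)" for z
    proof -
      have "i \<odot> (z \<odot> j) = (z \<odot> j) \<odot> i"
        by (simp add: assoc[symmetric] z(2) distribs) (simp add: assoc j(3) distribs)
      then obtain a b where ab: "z \<odot> j = a *\<^sub>R e + b *\<^sub>R i"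
        using commuting_with_imaginary[OF i] closed[OF z(1) j(1)] by blast
      have "c *\<^sub>R z = z \<odot> j \<odot> j" using z(1) by (simp add: assoc c(2) distribs)
      also have "\<dots> = a *\<^sub>R j + b *\<^sub>R (i \<odot> j)" using j(1) by (simp add: ab distribs)
      finally have "inverse c *\<^sub>R c *\<^sub>R z = inverse c *\<^sub>R (a *\<^sub>R j + b *\<^sub>R (i \<odot> j))" by simp
      then have "z = (inverse c * a) *\<^sub>R j + (inverse c * b) *\<^sub>R (i \<odot> j)"
        using c(1) by (simp add: scaleR_add_right)
      then show ?thesis by blast
    qed
    then show ?thesis using j(1) by blast
  qed
  then obtain j where j: "j \<in> D"
    "\<And>z. z \<in> D \<Longrightarrow> i \<odot> z = - (z \<odot> i) \<Longrightarrow> \<exists>a b. z = a *\<^sub>R j + b *\<^sub>R (i \<odot> j)" by blast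
  let ?Q = "{e, i, j, i \<odot> j}"
  have "x \<in> span ?Q" if x: "x \<in> D" for x
  proof -
    \<comment> \<open>As \<open>i\<^sup>2 = - e\<close>, these are the parts of \<open>x\<close> that commute and anticommute with \<open>i\<close>.\<close>
    define p where "p = (1/2) *\<^sub>R (x - i \<odot> (x \<odot> i))"
    define q where "q = (1/2) *\<^sub>R (x + i \<odot> (x \<odot> i))"
    have D: "p \<in> D" "q \<in> D" unfolding p_def q_def by (intro D_closed x i)+
    have "i \<odot> p = p \<odot> i" "i \<odot> q = - (q \<odot> i)"
      unfolding p_def q_def using x i by (simp_all add: distribs assoc ii D_closed algebra_simps)
    then obtain a b c d where "p = a *\<^sub>R e + b *\<^sub>R i" "q = c *\<^sub>R j + d *\<^sub>R (i \<odot> j)"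
      using commuting_with_imaginary[OF i D(1)] j(2)[OF D(2)] by metis
    moreover have "x = p + q" by (simp add: p_def q_def scaleR_add_right[symmetric] scaleR_2[symmetric])
    ultimately show ?thesis
      by (auto intro!: span_add span_scale intro: span_base)
  qed
  moreover have "card ?Q \<le> 4"
    by (simp add: card_insert_if)
  ultimately show ?thesis by (intro exI[of _ ?Q]) auto
qed

end

section \<open>Operators of minimal rank in a transitive algebra\<close>

lemma transitive_algebraD:
  assumes "transitive_algebra A"
  shows "subspace A" "S \<in> A \<Longrightarrow> T \<in> A \<Longrightarrow> S o\<^sub>L T \<in> A"
    and "\<epsilon> > 0 \<Longrightarrow> x \<noteq> 0 \<Longrightarrow> \<exists>T\<in>A. norm (blinfun_apply T x - y) < \<epsilon>"
  using assms by (auto simp: transitive_algebra_def operator_algebra_def)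

lemma linear_blinfun_apply: "linear (blinfun_apply w)"
  and linear_blinfun_eval: "linear (\<lambda>w. blinfun_apply w x)"
  by (simp_all add: bounded_linear.linear blinfun.bounded_linear_left blinfun.bounded_linear_right)

text \<open>
  The rank of \<open>F\<close> is measured by the size of a spanning set \<open>B\<close> of its range, which is minimal
  among all finite spanning sets of ranges of non-zero operators in \<open>A\<close>. In particular \<open>B\<close> is a basis
  of \<open>range F\<close>.
\<close>

locale minimal_rank_operator =
  fixes A :: "('a::real_normed_vector \<Rightarrow>\<^sub>L 'a) set" and F and B :: "'a set"
  assumes transitive: "transitive_algebra A"
    and F: "F \<in> A" "F \<noteq> 0"
    and finite_B: "finite B"
    and range_F: "range (blinfun_apply F) = span B"
    and minimal: "G \<in> A \<Longrightarrow> G \<noteq> 0 \<Longrightarrow> finite C \<Longrightarrow> range (blinfun_apply G) = span C \<Longrightarrow> card B \<le> card C"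
begin

text \<open>
  The right ideal of operators in \<open>A\<close> with range in that of \<open>F\<close>.
\<close>

definition W :: "('a \<Rightarrow>\<^sub>L 'a) set" where
  "W = {w \<in> A. range (blinfun_apply w) \<subseteq> span B}"

lemma subspace_A: "subspace A" and comp_A: "S \<in> A \<Longrightarrow> T \<in> A \<Longrightarrow> S o\<^sub>L T \<in> A"
  using transitive_algebraD[OF transitive] by auto

lemma W_apply: "w \<in> W \<Longrightarrow> blinfun_apply w x \<in> span B"
  by (auto simp: W_def)

lemma W_in_A: "w \<in> W \<Longrightarrow> w \<in> A"
  by (simp add: W_def)

lemma W_comp: "w \<in> W \<Longrightarrow> T \<in> A \<Longrightarrow> w o\<^sub>L T \<in> W"
  by (auto simp: W_def comp_A)

lemma subspace_W: "subspace W"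
  using subspace_A
  by (auto simp: W_def subspace_def blinfun.bilinear_simps span_zero intro!: span_add span_scale)

lemma F_in_W: "F \<in> W"
  using F range_F by (simp add: W_def)

text \<open>
  If \<open>w\<close> kills \<open>v\<close>, then a basis of \<open>range F\<close> through \<open>v\<close> shows that the range of \<open>w F\<close> is spanned by fewer
  than \<open>card B\<close> vectors, so \<open>w F = 0\<close> by minimality.
\<close>

lemma W_eq_0_on_span:
  assumes w: "w \<in> W" and v: "v \<in> span B" "v \<noteq> 0" "blinfun_apply w v = 0" and u: "u \<in> span B"
  shows "blinfun_apply w u = 0"
proof -
  have lin: "linear (blinfun_apply w)" by (simp add: linear_blinfun_apply)
  obtain C where C: "{v} \<subseteq> C" "C \<subseteq> span B" "independent C" "span B \<subseteq> span C"
    using maximal_independent_subset_extend[of "{v}" "span B"] v by auto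
  have card_C: "finite C" "card C \<le> card B"
    using independent_span_bound[OF finite_B C(3,2)] by auto
  have "span C = span B" using C by (meson span_minimal subset_antisym subspace_span)
  then have "range (blinfun_apply (w o\<^sub>L F)) = blinfun_apply w ` span C"
    using range_F by (auto simp: image_image[symmetric])
  also have "\<dots> = span (blinfun_apply w ` C)" by (simp add: linear_span_image[OF lin])
  also have "blinfun_apply w ` C = insert 0 (blinfun_apply w ` (C - {v}))"
    using C(1) v(3) by force
  also have "span \<dots> = span (blinfun_apply w ` (C - {v}))" by simp
  finally have range: "range (blinfun_apply (w o\<^sub>L F)) = span (blinfun_apply w ` (C - {v}))" .
  have "card (blinfun_apply w ` (C - {v})) \<le> card (C - {v})"
    using card_C(1) by (intro card_image_le) simp
  also have "\<dots> < card B"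
    using card_C C(1) by (metis card_Diff1_less insert_subset order_less_le_trans)
  finally have "w o\<^sub>L F = 0"
    using minimal[OF _ _ _ range] comp_A W_in_A[OF w] F(1) card_C(1) by (meson finite_Diff finite_imageI not_le)
  moreover obtain x where "u = blinfun_apply F x" using u range_F by blast
  ultimately show ?thesis by (metis blinfun_apply_blinfun_compose zero_blinfun.rep_eq)
qed

text \<open>
  For \<open>u = F z\<close>, transitivity yields \<open>T x\<close> close to \<open>z\<close>, hence \<open>F T x\<close> close to \<open>u\<close>. The orbit of \<open>x\<close>
  under \<open>W\<close> is a subspace of a finite-dimensional space, hence closed, so approximation gives
  equality.
\<close>

lemma W_onto:
  assumes "x \<noteq> 0" "u \<in> span B"
  obtains w where "w \<in> W" "blinfun_apply w x = u"
proof -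
  let ?U = "(\<lambda>w. blinfun_apply w x) ` W"
  have "subspace ?U"
    using subspace_W by (intro linear_subspace_image) (simp_all add: linear_blinfun_eval)
  then have "closed ?U"
    by (rule closed_finite_dim_subspace[OF _ _ finite_B]) (auto intro: W_apply)
  obtain z where z: "u = blinfun_apply F z" using assms(2) range_F by blast
  have "u \<in> closure ?U" unfolding closure_approachable
  proof (intro allI impI)
    fix \<epsilon> :: real assume "\<epsilon> > 0"
    moreover have "norm F > 0" using F(2) by simp
    ultimately obtain T where T: "T \<in> A" "norm (blinfun_apply T x - z) < \<epsilon> / norm F"
      using transitive_algebraD(3)[OF transitive, of "\<epsilon> / norm F" x z] assms(1) by auto
    have "norm (blinfun_apply F (blinfun_apply T x - z)) \<le> norm F * norm (blinfun_apply T x - z)"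
      by (rule norm_blinfun)
    also have "\<dots> < \<epsilon>" using T(2) \<open>norm F > 0\<close> by (simp add: field_simps)
    finally have "dist (blinfun_apply (F o\<^sub>L T) x) u < \<epsilon>"
      by (simp add: dist_norm z blinfun.diff_right)
    then show "\<exists>y\<in>?U. dist y u < \<epsilon>" using W_comp[OF F_in_W T(1)] by blast
  qed
  then show thesis using \<open>closed ?U\<close> that by auto
qed

lemma nonzero_in_span: obtains v where "v \<in> span B" "v \<noteq> 0"
proof -
  have "\<exists>x. blinfun_apply F x \<noteq> 0" using F(2) by (metis blinfun_eqI zero_blinfun.rep_eq)
  then show thesis using that range_F by blast
qed

text \<open>
  An element \<open>e\<close> that fixes a single non-zero \<open>v\<close> is the identity: \<open>e\<^sup>2 - e\<close> kills \<open>v\<close>, so \<open>e\<close> is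
  idempotent on \<open>range F\<close>; if \<open>e u \<noteq> u\<close>, then \<open>e\<close> kills the non-zero vector \<open>e u - u\<close>, hence also \<open>v\<close>.
\<close>

lemma W_unit:
  obtains e where "e \<in> W" "\<And>u. u \<in> span B \<Longrightarrow> blinfun_apply e u = u"
proof -
  obtain v where v: "v \<in> span B" "v \<noteq> 0" using nonzero_in_span .
  obtain e where e: "e \<in> W" "blinfun_apply e v = v" using W_onto[OF v(2,1)] .
  have idem: "blinfun_apply e (blinfun_apply e u) = blinfun_apply e u" if "u \<in> span B" for u
  proof -
    have W: "(e o\<^sub>L e) - e \<in> W" using e(1) by (intro subspace_diff[OF subspace_W] W_comp W_in_A)
    have "blinfun_apply ((e o\<^sub>L e) - e) u = 0"
      using W_eq_0_on_span[OF W v _ that] e(2) by (simp add: blinfun.bilinear_simps)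
    then show ?thesis by (simp add: blinfun.bilinear_simps)
  qed
  have "blinfun_apply e u = u" if u: "u \<in> span B" for u
  proof (rule ccontr)
    assume "blinfun_apply e u \<noteq> u"
    then have "blinfun_apply e v = 0"
      using W_eq_0_on_span[OF e(1), of "blinfun_apply e u - u" v] u v(1) W_apply[OF e(1)] idem[OF u]
      by (simp add: span_diff blinfun.bilinear_simps)
    then show False using e(2) v(2) by simp
  qed
  then show thesis using that e(1) by blast
qed

text \<open>
  The corner \<open>D = {w \<in> W. w e = w}\<close> is a division algebra, because a non-zero element is injective
  on \<open>range F\<close>. Evaluation at \<open>v\<close> identifies it with \<open>range F\<close>, which both shows that \<open>D\<close> has finite
  dimension and carries the bound of Frobenius over to \<open>range F\<close>.
\<close>

lemma minimal_range_le_4: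
  obtains Q where "finite Q" "card Q \<le> 4" "span B \<subseteq> span Q"
proof -
  obtain v where v: "v \<in> span B" "v \<noteq> 0" using nonzero_in_span .
  obtain e where e: "e \<in> W" "\<And>u. u \<in> span B \<Longrightarrow> blinfun_apply e u = u" using W_unit by blast
  define D where "D = {w \<in> W. w o\<^sub>L e = w}"
  have D_iff: "w \<in> D \<longleftrightarrow> w \<in> W \<and> (\<forall>x. blinfun_apply w (blinfun_apply e x) = blinfun_apply w x)" for w
    by (metis (mono_tags, lifting) D_def blinfun_apply_blinfun_compose blinfun_eqI mem_Collect_eq)
  have e_idem: "blinfun_apply e (blinfun_apply e x) = blinfun_apply e x" for x
    using e W_apply by blast
  have comp_e: "w o\<^sub>L e \<in> D" if "w \<in> W" for w
    using W_comp[OF that W_in_A[OF e(1)]] by (simp add: D_iff e_idem)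
  have zero: "w = 0" if "w \<in> D" "u \<in> span B" "u \<noteq> 0" "blinfun_apply w u = 0" for w u
  proof (rule blinfun_eqI)
    fix x
    have w: "w \<in> W" "blinfun_apply w (blinfun_apply e x) = blinfun_apply w x"
      using that(1) by (auto simp: D_iff)
    have "blinfun_apply w (blinfun_apply e x) = 0"
      using W_eq_0_on_span[OF w(1) that(2-4)] W_apply[OF e(1)] by blast
    then show "blinfun_apply w x = blinfun_apply 0 x" using w(2) by simp
  qed
  have sub: "subspace D"
    using subspace_W unfolding subspace_def by (simp add: D_iff blinfun.bilinear_simps)
  have lin: "linear (\<lambda>w. blinfun_apply w v)" by (simp add: linear_blinfun_eval)
  have onto: "\<exists>d\<in>D. blinfun_apply d v = u" if u: "u \<in> span B" for u
  proof -
    obtain w where "w \<in> W" "blinfun_apply w v = u" using W_onto[OF v(2) u] .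
    then show ?thesis using comp_e[of w] e(2)[OF v(1)] by (intro bexI[of _ "w o\<^sub>L e"]) auto
  qed
  then obtain d where d: "\<And>b. b \<in> B \<Longrightarrow> d b \<in> D" "\<And>b. b \<in> B \<Longrightarrow> blinfun_apply (d b) v = b"
    using span_base by metis
  have fin: "D \<subseteq> span (d ` B)"
  proof
    fix w assume w: "w \<in> D"
    have "blinfun_apply w v \<in> span ((\<lambda>w. blinfun_apply w v) ` d ` B)"
      using w d(2) W_apply[of w v] by (simp add: image_image D_iff)
    then obtain w' where w': "w' \<in> span (d ` B)" "blinfun_apply w v = blinfun_apply w' v"
      by (auto simp: linear_span_image[OF lin])
    have "span (d ` B) \<subseteq> D" by (rule span_minimal) (use d(1) sub in auto)
    then have "w' \<in> D" using w'(1) by blast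
    then have "w - w' = 0"
      using w w'(2) subspace_diff[OF sub] by (intro zero[OF _ v]) (simp_all add: blinfun.diff_left)
    then show "w \<in> span (d ` B)" using w'(1) by simp
  qed
  interpret finite_dim_division_algebra "(o\<^sub>L)" D e "d ` B"
  proof
    show "bilinear ((o\<^sub>L) :: ('a \<Rightarrow>\<^sub>L 'a) \<Rightarrow> _)"
      by (auto simp: bilinear_def intro!: linearI blinfun_eqI simp: blinfun.bilinear_simps)
    show "x o\<^sub>L y o\<^sub>L z = x o\<^sub>L (y o\<^sub>L z)" for x y z :: "'a \<Rightarrow>\<^sub>L 'a"
      by (rule blinfun_eqI) simp
    show "subspace D" by (rule sub)
    show "x o\<^sub>L y \<in> D" if "x \<in> D" "y \<in> D" for x y
      using that W_comp[of x y] W_in_A[of y] by (simp add: D_iff)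
    show "e \<in> D" using e(1) e_idem by (simp add: D_iff)
    show "e o\<^sub>L x = x" if "x \<in> D" for x
      using that e(2) W_apply by (intro blinfun_eqI) (simp add: D_iff)
    show "x o\<^sub>L e = x" if "x \<in> D" for x using that by (simp add: D_def)
    show "x = 0 \<or> y = 0" if "x \<in> D" "y \<in> D" "x o\<^sub>L y = 0" for x y
    proof (rule disjCI)
      assume "y \<noteq> 0"
      then obtain z where "blinfun_apply y z \<noteq> 0" by (metis blinfun_eqI zero_blinfun.rep_eq)
      moreover have "blinfun_apply x (blinfun_apply y z) = 0"
        using that(3) by (metis blinfun_apply_blinfun_compose zero_blinfun.rep_eq)
      ultimately show "x = 0" using zero[OF that(1)] that(2) W_apply D_iff by blast
    qed
  qed (use fin finite_B in auto)
  obtain Q where Q: "finite Q" "card Q \<le> 4" "D \<subseteq> span Q" using frobenius_dimension by blast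
  let ?Q = "(\<lambda>w. blinfun_apply w v) ` Q"
  have "span B \<subseteq> span ?Q"
    unfolding linear_span_image[OF lin] using onto Q(3) by blast
  moreover have "card ?Q \<le> 4" using card_image_le[OF Q(1)] Q(2) le_trans by blast
  ultimately show thesis using that Q(1) by blast
qed

section \<open>Dual systems\<close>

text \<open>
  The operators \<open>w j\<close> act on the vectors \<open>x l\<close> like a dual family of coordinate functionals with
  values in the line through \<open>v\<close>.
\<close>

definition dual_system :: "('i \<Rightarrow> 'a) \<Rightarrow> 'a \<Rightarrow> 'i set \<Rightarrow> ('i \<Rightarrow> ('a \<Rightarrow>\<^sub>L 'a)) \<Rightarrow> bool" where
  "dual_system x v J w \<longleftrightarrow>
    (\<forall>j\<in>J. w j \<in> W \<and> (\<forall>l\<in>J. blinfun_apply (w j) (x l) = (if l = j then v else 0)))"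

text \<open>
  Subtracting from \<open>u\<close> its expansion in the dual system; the coefficients \<open>d j\<close> are operators with
  \<open>d j v = u (x j)\<close>.
\<close>

lemma dual_system_reduce:
  assumes "dual_system x v J w" "finite J" "v \<noteq> 0" "u \<in> W"
  obtains d where "\<And>j. j \<in> J \<Longrightarrow> d j \<in> W"
    "\<And>l. l \<in> J \<Longrightarrow> blinfun_apply (u - (\<Sum>j\<in>J. d j o\<^sub>L w j)) (x l) = 0"
proof -
  have "\<exists>d. d \<in> W \<and> blinfun_apply d v = blinfun_apply u (x j)" for j
    using W_onto[OF assms(3) W_apply[OF assms(4)]] by metis
  then obtain d where d: "\<And>j. d j \<in> W" "\<And>j. blinfun_apply (d j) v = blinfun_apply u (x j)" by metis
  have "blinfun_apply (u - (\<Sum>j\<in>J. d j o\<^sub>L w j)) (x l) = 0" if l: "l \<in> J" for l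
  proof -
    have "(\<Sum>j\<in>J. blinfun_apply (d j) (blinfun_apply (w j) (x l)))
        = (\<Sum>j\<in>J. if l = j then blinfun_apply u (x l) else 0)"
      using assms(1) l d(2) by (intro sum.cong) (auto simp: dual_system_def)
    then show ?thesis using l assms(2)
      by (simp add: blinfun.bilinear_simps blinfun.sum_left)
  qed
  then show thesis using that d(1) by blast
qed

text \<open>
  Composing \<open>u\<close> on the left with suitable elements of \<open>W\<close> gives an operator that is dual to \<open>x i\<close>, and
  corrections that make the old operators vanish at \<open>x i\<close>. Neither changes values at \<open>x l\<close> for
  \<open>l \<in> J\<close>, since \<open>u\<close> vanishes there.
\<close>

lemma dual_system_extend:
  assumes w: "dual_system x v J w" and v: "v \<in> span B" and i: "i \<notin> J"
    and u: "u \<in> W" "blinfun_apply u (x i) \<noteq> 0" "\<And>l. l \<in> J \<Longrightarrow> blinfun_apply u (x l) = 0"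
  shows "\<exists>w. dual_system x v (insert i J) w"
proof -
  have onto: "\<exists>d. d \<in> W \<and> blinfun_apply d (blinfun_apply u (x i)) = y" if "y \<in> span B" for y
    using W_onto[OF u(2) that] by metis
  obtain d where d: "d \<in> W" "blinfun_apply d (blinfun_apply u (x i)) = v" using onto[OF v] by blast
  have "\<exists>d. d \<in> W \<and> blinfun_apply d (blinfun_apply u (x i)) = blinfun_apply (w j) (x i)" if "j \<in> J" for j
    using onto w that by (auto simp: dual_system_def W_apply)
  then obtain c where c: "\<And>j. j \<in> J \<Longrightarrow> c j \<in> W"
    "\<And>j. j \<in> J \<Longrightarrow> blinfun_apply (c j) (blinfun_apply u (x i)) = blinfun_apply (w j) (x i)" by metis
  \<comment> \<open>\<open>c j\<close> maps \<open>u (x i)\<close> to the unwanted value of \<open>w j\<close> at \<open>x i\<close>, and \<open>d\<close> maps it to \<open>v\<close>.\<close>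
  let ?w = "\<lambda>j. if j = i then d o\<^sub>L u else w j - (c j o\<^sub>L u)"
  have "dual_system x v (insert i J) ?w"
    using w d c u(1,3) i
    by (auto simp: dual_system_def blinfun.bilinear_simps intro!: W_comp W_in_A subspace_diff[OF subspace_W])
  then show ?thesis by blast
qed

text \<open>
  For a maximal \<open>J\<close>, operators of \<open>W\<close> are determined on the span of all \<open>x i\<close> by their values at the
  \<open>x j\<close> with \<open>j \<in> J\<close>. If \<open>J\<close> were too small, the kernels of the \<open>w j\<close> would have a common non-zero vector
  \<open>y\<close> in that span. Every \<open>u \<in> W\<close> agrees there with its expansion in the \<open>w j\<close>, so \<open>u y = 0\<close>, which
  contradicts \<open>W_onto\<close>.
\<close>

lemma large_dual_system:
  fixes x :: "'i \<Rightarrow> 'a"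
  assumes I: "finite I" "inj_on x I" "independent (x ` I)" and v: "v \<in> span B" "v \<noteq> 0"
  obtains J w where "J \<subseteq> I" "dual_system x v J w" "card I \<le> 4 * card J"
proof -
  obtain Q where Q: "finite Q" "card Q \<le> 4" "span B \<subseteq> span Q" using minimal_range_le_4 .
  define good where "good J \<longleftrightarrow> J \<subseteq> I \<and> (\<exists>w. dual_system x v J w)" for J
  have "good {}" by (simp add: good_def dual_system_def)
  moreover have "\<forall>J. good J \<longrightarrow> card J < Suc (card I)"
    using card_mono[OF I(1)] by (simp add: good_def less_Suc_eq_le)
  ultimately have "\<exists>J. good J \<and> (\<forall>J'. good J' \<longrightarrow> card J' \<le> card J)"
    by (rule Lattices_Big.ex_has_greatest_nat)
  then obtain J where good_J: "good J" and max: "\<And>J'. good J' \<Longrightarrow> card J' \<le> card J" by blast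
  then have J: "J \<subseteq> I" by (simp add: good_def)
  obtain w where w: "dual_system x v J w" using good_J good_def by blast
  have finJ: "finite J" using J I(1) finite_subset by blast
  have ann: "blinfun_apply u y = 0"
    if u: "u \<in> W" "\<And>l. l \<in> J \<Longrightarrow> blinfun_apply u (x l) = 0" and y: "y \<in> span (x ` I)" for u y
  proof -
    have "blinfun_apply u (x i) = 0" if "i \<in> I" for i
    proof (rule ccontr)
      assume "blinfun_apply u (x i) \<noteq> 0"
      moreover from this have "i \<notin> J" using u(2) by blast
      ultimately have "good (insert i J)"
        using dual_system_extend[OF w v(1) _ u(1) _ u(2), of i] J that by (auto simp: good_def)
      then have "card (insert i J) \<le> card J" by (rule max)
      then show False using \<open>i \<notin> J\<close> finJ by simp
    qed
    then show ?thesis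
      using linear_eq_0_on_span[of "blinfun_apply u" "x ` I" y] y by (auto simp: linear_blinfun_apply)
  qed
  have "card I \<le> 4 * card J"
  proof (rule ccontr)
    assume "\<not> card I \<le> 4 * card J"
    then have "card J * card Q < card (x ` I)"
      using Q(2) I(2) by (simp add: card_image) (metis le_trans mult.commute mult_le_mono2 not_le)
    moreover have "blinfun_apply (w j) z \<in> span Q" if "j \<in> J" for j z
      using that w Q(3) W_apply[of "w j" z] by (auto simp: dual_system_def)
    ultimately have "\<exists>y\<in>span (x ` I). y \<noteq> 0 \<and> (\<forall>j\<in>J. blinfun_apply (w j) y = 0)"
      using I by (intro common_kernel_vector[OF finJ Q(1)] linear_blinfun_apply) auto
    then obtain y where y: "y \<in> span (x ` I)" "y \<noteq> 0" "\<forall>j\<in>J. blinfun_apply (w j) y = 0"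
      by blast
    have "blinfun_apply u y = 0" if u: "u \<in> W" for u
    proof -
      obtain d where d: "\<And>j. j \<in> J \<Longrightarrow> d j \<in> W"
        "\<And>l. l \<in> J \<Longrightarrow> blinfun_apply (u - (\<Sum>j\<in>J. d j o\<^sub>L w j)) (x l) = 0"
        using dual_system_reduce[OF w finJ v(2) u] by blast
      have "u - (\<Sum>j\<in>J. d j o\<^sub>L w j) \<in> W"
        using u d(1) w by (intro subspace_diff[OF subspace_W] subspace_sum[OF subspace_W] W_comp)
          (auto simp: dual_system_def W_in_A)
      then have "blinfun_apply (u - (\<Sum>j\<in>J. d j o\<^sub>L w j)) y = 0" using ann d(2) y(1) by blast
      then show ?thesis using y(3) by (simp add: blinfun.bilinear_simps blinfun.sum_left)
    qed
    moreover obtain u where "u \<in> W" "blinfun_apply u y = v" using W_onto[OF y(2) v(1)] .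
    ultimately show False using v(2) by simp
  qed
  then show thesis using that J w by blast
qed

theorem one_over_dense_4: "one_over_dense 4 A"
  unfolding one_over_dense_def independent_family_def
proof (intro allI impI, elim conjE)
  fix \<epsilon> :: real and n :: nat and x y :: "nat \<Rightarrow> 'a"
  assume \<epsilon>: "\<epsilon> > 0" and x: "inj_on x {1..4 * n}" "independent (x ` {1..4 * n})"
  obtain v where v: "v \<in> span B" "v \<noteq> 0" using nonzero_in_span .
  obtain J w where J: "J \<subseteq> {1..4 * n}" "dual_system x v J w" "n \<le> card J"
    using large_dual_system[OF _ x v] by auto
  then obtain j where j: "j ` {1..n} \<subseteq> J" "inj_on j {1..n}"
    using card_le_inj[of "{1..n}" J] finite_subset[OF J(1)] by auto
  have "\<exists>S. S \<in> A \<and> norm (blinfun_apply S v - y i) < \<epsilon>" for i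
    using transitive_algebraD(3)[OF transitive \<epsilon> v(2)] by blast
  then obtain S where S: "\<And>i. S i \<in> A" "\<And>i. norm (blinfun_apply (S i) v - y i) < \<epsilon>" by metis
  have w: "w (j l) \<in> W" if "l \<in> {1..n}" for l
    using that J(2) j(1) by (auto simp: dual_system_def image_subset_iff)
  let ?T = "\<Sum>l\<in>{1..n}. S l o\<^sub>L w (j l)"
  have "?T \<in> A"
    using S(1) W_in_A[OF w] by (intro subspace_sum[OF subspace_A] comp_A) blast+
  moreover have "blinfun_apply ?T (x (j i)) = blinfun_apply (S i) v" if i: "i \<in> {1..n}" for i
  proof -
    have "blinfun_apply (S l) (blinfun_apply (w (j l)) (x (j i))) = (if l = i then blinfun_apply (S i) v else 0)"
      if "l \<in> {1..n}" for l
      using J(2) j i that inj_on_eq_iff[OF j(2) i that] by (auto simp: dual_system_def image_subset_iff)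
    then show ?thesis using i by (simp add: blinfun.sum_left)
  qed
  moreover have "\<forall>i\<in>{1..n}. j i \<in> {1..4 * n}" using j(1) J(1) by blast
  ultimately show "\<exists>j. (\<forall>i\<in>{1..n}. j i \<in> {1..4 * n}) \<and>
           (\<exists>T\<in>A. \<forall>i\<in>{1..n}. norm (y i - blinfun_apply T (x (j i))) < \<epsilon>)"
    using S(2) by (intro exI[of _ j] conjI bexI[of _ ?T]) (auto simp: norm_minus_commute)
qed

end

section \<open>Density of L-algebras\<close>

lemma minimal_rank_operator_exists:
  assumes "L_algebra A"
  obtains F B where "minimal_rank_operator A F B"
proof -
  let ?P = "\<lambda>n. \<exists>F B. F \<in> A \<and> F \<noteq> 0 \<and> finite B \<and> range (blinfun_apply F) = span B \<and> card B = n"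
  have "\<exists>n. ?P n" using assms by (auto simp: L_algebra_def finite_rank_def)
  then have "?P (LEAST n. ?P n)" by (rule LeastI_ex)
  then obtain F B where FB: "F \<in> A" "F \<noteq> 0" "finite B" "range (blinfun_apply F) = span B"
    "card B = (LEAST n. ?P n)" by blast
  have "minimal_rank_operator A F B"
  proof
    show "transitive_algebra A" using assms by (simp add: L_algebra_def)
    show "card B \<le> card C"
      if "G \<in> A" "G \<noteq> 0" "finite C" "range (blinfun_apply G) = span C" for G C
      unfolding FB(5) using that by (intro Least_le) blast
  qed (use FB in auto)
  then show thesis using that by blast
qed

theorem theorem2p3:
  fixes A :: "('a::banach \<Rightarrow>\<^sub>L 'a) set"
  assumes "infinite_dimensional TYPE('a)"
    and "L_algebra A"
  shows "one_over_dense 4 A"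
proof -
  obtain F B where "minimal_rank_operator A F B"
    using minimal_rank_operator_exists[OF assms(2)] .
  then show ?thesis by (rule minimal_rank_operator.one_over_dense_4)
qed

end
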